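(* Fix a mass $m>0$ and a finite line of length $L_0$ with periodic boundary conditions, so that momenta are quantized, $p\in\frac{2\pi}{L_0}\mathbb{Z}$. For lattice spacing $a$ (with $L_0/a$ an integer) and momentum cutoff $\Lambda<\pi/a$, let $\ket{\Omega_\Lambda}=\prod_{|p|\le\Lambda}c_p^\dagger\ket0$ be the truncated continuum Dirac vacuum and $\ket{\Omega_{d\Lambda}}=\prod_{|p|\le\Lambda}C_p^\dagger\ket0$ the truncated discrete Dirac vacuum in one dimension (products taken in the same order). Then the discrete vacua converge, in the sense that $$\left\|\ket{\Omega_\Lambda}-\ket{\Omega_{d\Lambda}}\right\|_2=O(\Lambda^3a),$$ which tends to zero as the lattice spacing tends to zero (provided $\Lambda=\Lambda(a)\to\infty$ sufficiently slowly as $a\to0$, so that $\Lambda^3a\to0$).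
   Context: For each momentum $p$ and $\alpha\in\{r,l\}$ let $\psi_{p,\alpha}$ be fermionic annihilation operators, $\{\psi_{p,\alpha},\psi_{q,\beta}^\dagger\}=\delta_{pq}\delta_{\alpha\beta}$, $\{\psi_{p,\alpha},\psi_{q,\beta}\}=0$, with $\ket0$ the Fock state annihilated by all of them; discrete and continuum momentum creation operators with the same momentum are identified. Continuum negative-energy operators: $c_p^\dagger=\sum_\alpha w^-_\alpha(p)\psi^\dagger_{p,\alpha}$, where $w^-(p)\in\mathbb{C}^2$ is the normalized eigenvector of the one-dimensional Dirac Hamiltonian $h(p)=p\sigma_z+m\sigma_x$ with eigenvalue $-\sqrt{p^2+m^2}$. Discrete negative-energy operators: $C_p^\dagger=\sum_\alpha w^{-}_{d,\alpha}(p)\psi^\dagger_{p,\alpha}$, where $w_d^-(p)$ is the normalized eigenvector of $U(p)=e^{-im\sigma_xa}e^{-ip\sigma_za}$ with eigenvalue $\lambda_+(p)=\cos(ma)\cos(pa)+i\sqrt{1-\cos^2(ma)\cos^2(pa)}$ (the negative-energy eigenvalue). Matrices are written in the ordered basis $(r,l)$. Phases of the discrete eigenvectors, which are physically immaterial, are chosen so that the inner product $\langle w_d^-(p),w^-(p)\rangle$ is real and nonnegative. The $O(\cdot)$ is as $a\to0$ with $m,L_0$ fixed and $\Lambda=\Lambda(a)\to\infty$: the norm is at most $C\Lambda^3a$ for all sufficiently small $a$ with $C$ independent of $a$ and $\Lambda$. *)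

theory Defs
  imports "HOL-Analysis.Analysis"
begin

section \<open>Fermionic modes\<close>

text \<open>The inner product is linear in its second argument. The scalar multiplication is an explicit
  parameter because the libraries have no type class of complex inner product spaces.\<close>

locale complex_inner_product_space = vector_space smul
  for smul :: "complex \<Rightarrow> 'v::ab_group_add \<Rightarrow> 'v" +
  fixes ip :: "'v \<Rightarrow> 'v \<Rightarrow> complex"
  assumes ip_commute: "ip x y = cnj (ip y x)"
    and ip_add_right: "ip x (y + z) = ip x y + ip x z"
    and ip_scale_right: "ip x (smul c y) = c * ip x y"
    and ip_pos: "x \<noteq> 0 \<Longrightarrow> 0 < Re (ip x x)"

definition state_norm :: "('v \<Rightarrow> 'v \<Rightarrow> complex) \<Rightarrow> 'v \<Rightarrow> real" where
  "state_norm ip v = sqrt (Re (ip v v))"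

text \<open>The chirality index ranges over the two-element type \<open>2\<close>, with \<open>1\<close> for $r$ and \<open>2\<close> for $l$.
  \<open>psid p \<alpha>\<close> is the adjoint of \<open>psi p \<alpha>\<close>, and \<open>P\<close> is the set of admissible momenta; nothing is
  assumed about the operators at other momenta.\<close>

locale fermion_modes = complex_inner_product_space smul ip
  for smul :: "complex \<Rightarrow> 'v::ab_group_add \<Rightarrow> 'v" and ip :: "'v \<Rightarrow> 'v \<Rightarrow> complex" +
  fixes P :: "real set"
    and psi psid :: "real \<Rightarrow> 2 \<Rightarrow> 'v \<Rightarrow> 'v"
    and vac :: 'v
  assumes linear_psi: "p \<in> P \<Longrightarrow> Vector_Spaces.linear smul smul (psi p \<alpha>)"
    and linear_psid: "p \<in> P \<Longrightarrow> Vector_Spaces.linear smul smul (psid p \<alpha>)"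
    and adjoint: "p \<in> P \<Longrightarrow> ip (psi p \<alpha> u) v = ip u (psid p \<alpha> v)"
    and car_mixed: "p \<in> P \<Longrightarrow> q \<in> P \<Longrightarrow>
      psi p \<alpha> (psid q \<beta> v) + psid q \<beta> (psi p \<alpha> v) = (if p = q \<and> \<alpha> = \<beta> then v else 0)"
    and car_psi: "p \<in> P \<Longrightarrow> q \<in> P \<Longrightarrow> psi p \<alpha> (psi q \<beta> v) + psi q \<beta> (psi p \<alpha> v) = 0"
    and vac_annihilated: "p \<in> P \<Longrightarrow> psi p \<alpha> vac = 0"
    and vac_normalized: "ip vac vac = 1"

definition mode_creation ::
    "(complex \<Rightarrow> 'v::ab_group_add \<Rightarrow> 'v) \<Rightarrow> (real \<Rightarrow> 2 \<Rightarrow> 'v \<Rightarrow> 'v) \<Rightarrow>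
     (real \<Rightarrow> complex^2) \<Rightarrow> real \<Rightarrow> 'v \<Rightarrow> 'v" where
  "mode_creation smul psid w p v = (\<Sum>\<alpha>\<in>UNIV. smul (w p $ \<alpha>) (psid p \<alpha> v))"

text \<open>The list fixes the order of the product: the operator of its head is the leftmost factor.\<close>

definition filled_state ::
    "(complex \<Rightarrow> 'v::ab_group_add \<Rightarrow> 'v) \<Rightarrow> (real \<Rightarrow> 2 \<Rightarrow> 'v \<Rightarrow> 'v) \<Rightarrow> 'v \<Rightarrow>
     (real \<Rightarrow> complex^2) \<Rightarrow> real list \<Rightarrow> 'v" where
  "filled_state smul psid vac w ps = foldr (mode_creation smul psid w) ps vac"


section \<open>Momenta and lattice spacings\<close>

definition momenta :: "real \<Rightarrow> real set" where
  "momenta L0 = range (\<lambda>k::int. 2 * pi / L0 * of_int k)"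

definition cutoff_momenta :: "real \<Rightarrow> real \<Rightarrow> real set" where
  "cutoff_momenta L0 \<Lambda> = {p \<in> momenta L0. \<bar>p\<bar> \<le> \<Lambda>}"

definition lattice_spacings :: "real \<Rightarrow> real set" where
  "lattice_spacings L0 = {a. 0 < a \<and> L0 / a \<in> \<int>}"


section \<open>Single-particle Hamiltonian and walk operator\<close>

definition cinner2 :: "complex^2 \<Rightarrow> complex^2 \<Rightarrow> complex" where
  "cinner2 u v = (\<Sum>i\<in>UNIV. cnj (u $ i) * v $ i)"

definition sigma_x :: "complex^2^2" where
  "sigma_x = vector [vector [0, 1], vector [1, 0]]"

definition sigma_z :: "complex^2^2" where
  "sigma_z = vector [vector [1, 0], vector [0, -1]]"

definition cscale_mat :: "complex \<Rightarrow> complex^2^2 \<Rightarrow> complex^2^2" where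
  "cscale_mat c A = (\<chi> i j. c * A $ i $ j)"

text \<open>Multiplication in the type \<open>complex^2^2\<close> is componentwise, so neither its power nor the
  library exponential is the matrix one.\<close>

definition mat_exp :: "complex^2^2 \<Rightarrow> complex^2^2" where
  "mat_exp A = (\<Sum>n. (1 / fact n) *\<^sub>R (((**) A) ^^ n) (mat 1))"

definition dirac_hamiltonian :: "real \<Rightarrow> real \<Rightarrow> complex^2^2" where
  "dirac_hamiltonian m p = p *\<^sub>R sigma_z + m *\<^sub>R sigma_x"

definition walk_operator :: "real \<Rightarrow> real \<Rightarrow> real \<Rightarrow> complex^2^2" where
  "walk_operator m a p =
     mat_exp (cscale_mat (- \<i> * of_real (m * a)) sigma_x) **
     mat_exp (cscale_mat (- \<i> * of_real (p * a)) sigma_z)"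

definition walk_eigenvalue :: "real \<Rightarrow> real \<Rightarrow> real \<Rightarrow> complex" where
  "walk_eigenvalue m a p =
     Complex (cos (m * a) * cos (p * a)) (sqrt (1 - (cos (m * a))\<^sup>2 * (cos (p * a))\<^sup>2))"

definition normalized_eigenvector :: "complex^2^2 \<Rightarrow> complex \<Rightarrow> complex^2 \<Rightarrow> bool" where
  "normalized_eigenvector A c w \<longleftrightarrow> A *v w = c *s w \<and> norm w = 1"

end

theory Submission
  imports Defs
begin

text \<open>A creation operator of amplitude $w$ has norm at most $\|w\|$, so exchanging the modes one at
  a time bounds the distance of the two vacua by $\sum_{|p| \le \Lambda} \|w^-(p) - w_d^-(p)\|$.
  Up to a multiple of the identity and a factor $-i$, the walk operator is a Hermitian matrix $K$
  that agrees with $a\,h(p)$ up to $O((a\omega)^2)$, where $\omega = \sqrt{p^2+m^2}$, while its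
  spectral gap is of order $a\omega$. Hence the component of $w^-(p)$ orthogonal to $w_d^-(p)$ is
  $O(a\omega)$, and by the phase convention so is $w^-(p) - w_d^-(p)$. Summing over $O(\Lambda)$
  momenta gives $O(\Lambda^2 a)$, which is stronger than $O(\Lambda^3 a)$.\<close>


section \<open>Creation operators on the many-particle space\<close>

context complex_inner_product_space
begin

lemma ip_zero_right [simp]: "ip x 0 = 0"
  using ip_add_right[of x 0 0] by simp

lemma ip_add_left: "ip (x + y) z = ip x z + ip y z"
  by (metis complex_cnj_add ip_add_right ip_commute)

lemma ip_scale_left: "ip (smul c x) y = cnj c * ip x y"
  by (metis complex_cnj_mult ip_commute ip_scale_right)

lemma ip_zero_left [simp]: "ip 0 x = 0"
  using ip_add_left[of 0 0 x] by simp

lemma ip_diff_right: "ip x (y - z) = ip x y - ip x z"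
  using ip_add_right[of x "y - z" z] by simp

lemma ip_self_nonneg: "0 \<le> Re (ip x x)"
  by (cases "x = 0") (auto simp: less_imp_le ip_pos)

lemma Im_ip_self [simp]: "Im (ip x x) = 0"
  using ip_commute[of x x] by (metis Reals_cnj_iff complex_is_Real_iff)

lemma ip_self_eq: "ip x x = of_real ((state_norm ip x)\<^sup>2)"
  using ip_self_nonneg[of x] by (simp add: complex_eq_iff state_norm_def)

lemma state_norm_nonneg [simp]: "0 \<le> state_norm ip x"
  by (simp add: state_norm_def ip_self_nonneg)

lemma state_norm_zero [simp]: "state_norm ip 0 = 0"
  by (simp add: state_norm_def)

lemma Cauchy_Schwarz: "cmod (ip x y) \<le> state_norm ip x * state_norm ip y"
proof (cases "x = 0")
  case False
  define n where "n = (state_norm ip x)\<^sup>2"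
  have n: "n > 0"
    using ip_pos[OF False] ip_self_eq[of x] by (simp add: n_def)
  \<comment> \<open>With this coefficient \<open>smul c x + y\<close> is orthogonal to
    \<open>x\<close>, and nonnegativity of its squared norm is the inequality.\<close>
  define c where "c = - ip x y / of_real n"
  have "ip (smul c x + y) (smul c x + y)
      = cnj c * c * of_real n + cnj c * ip x y + c * cnj (ip x y) + of_real ((state_norm ip y)\<^sup>2)"
    by (simp add: ip_add_left ip_add_right ip_scale_left ip_scale_right
        ip_self_eq[of x] ip_self_eq[of y] n_def ip_commute[of y x] algebra_simps)
  also have "\<dots> = of_real ((state_norm ip y)\<^sup>2) - cnj (ip x y) * ip x y / of_real n"
    using n by (simp add: c_def field_simps)
  also have "cnj (ip x y) * ip x y = of_real ((cmod (ip x y))\<^sup>2)"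
    using complex_norm_square[of "ip x y"] by (simp add: mult.commute)
  finally have "Re (ip (smul c x + y) (smul c x + y)) = (state_norm ip y)\<^sup>2 - (cmod (ip x y))\<^sup>2 / n"
    by (metis (no_types) Re_complex_of_real of_real_diff of_real_divide)
  with ip_self_nonneg[of "smul c x + y"]
  have "(cmod (ip x y))\<^sup>2 / n \<le> (state_norm ip y)\<^sup>2"
    by linarith
  hence "(cmod (ip x y))\<^sup>2 \<le> (state_norm ip x * state_norm ip y)\<^sup>2"
    using n by (simp add: n_def power_mult_distrib field_simps)
  thus ?thesis
    by (rule power2_le_imp_le) simp
qed simp

lemma state_norm_triangle: "state_norm ip (x + y) \<le> state_norm ip x + state_norm ip y"
proof (rule power2_le_imp_le)
  have "(state_norm ip (x + y))\<^sup>2 = Re (ip (x + y) (x + y))"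
    by (simp add: ip_self_eq)
  also have "\<dots> = Re (ip x x) + Re (ip y y) + 2 * Re (ip x y)"
    using ip_commute[of y x] by (simp add: ip_add_left ip_add_right)
  also have "\<dots> = (state_norm ip x)\<^sup>2 + (state_norm ip y)\<^sup>2 + 2 * Re (ip x y)"
    by (simp add: ip_self_eq)
  also have "\<dots> \<le> (state_norm ip x + state_norm ip y)\<^sup>2"
    using Cauchy_Schwarz[of x y] complex_Re_le_cmod[of "ip x y"] by (simp add: power2_sum)
  finally show "(state_norm ip (x + y))\<^sup>2 \<le> (state_norm ip x + state_norm ip y)\<^sup>2" .
qed simp

end

lemma norm_complex2_squared: "(norm (v :: complex^2))\<^sup>2 = (cmod (v $ 1))\<^sup>2 + (cmod (v $ 2))\<^sup>2"
  by (simp add: norm_vec_def L2_set_def sum_2)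

context fermion_modes
begin

text \<open>Since $c\,c^\dagger + c^\dagger c = \|w\|^2$ for $c^\dagger$ the creation operator of amplitude
  $w$, one has $\|c^\dagger v\|^2 = \|w\|^2\|v\|^2 - \|c v\|^2$.\<close>

lemma state_norm_mode_creation_le:
  assumes "p \<in> P"
  shows "state_norm ip (mode_creation smul psid w p v) \<le> norm (w p) * state_norm ip v"
proof (rule power2_le_imp_le)
  \<comment> \<open>\<open>y\<close> is the adjoint annihilation operator of amplitude
    \<open>w p\<close> applied to \<open>v\<close>; its squared norm is the defect in the
    bound.\<close>
  define y where "y = smul (cnj (w p $ 1)) (psi p 1 v) + smul (cnj (w p $ 2)) (psi p 2 v)"
  have swap: "ip (psid p \<alpha> v) (psid p \<beta> v) =
      (if \<alpha> = \<beta> then ip v v else 0) - ip (psi p \<beta> v) (psi p \<alpha> v)" for \<alpha> \<beta>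
  proof -
    have "ip (psid p \<alpha> v) (psid p \<beta> v) = ip v (psi p \<alpha> (psid p \<beta> v))"
      by (metis adjoint[OF assms] ip_commute)
    also have "psi p \<alpha> (psid p \<beta> v) = (if \<alpha> = \<beta> then v else 0) - psid p \<beta> (psi p \<alpha> v)"
      using car_mixed[OF assms assms, of \<alpha> \<beta> v] by (simp add: algebra_simps)
    finally show ?thesis
      by (simp add: ip_diff_right adjoint[OF assms] del: diff_0)
  qed
  have "ip (mode_creation smul psid w p v) (mode_creation smul psid w p v)
      = (cnj (w p $ 1) * w p $ 1 + cnj (w p $ 2) * w p $ 2) * ip v v - ip y y"
    by (simp add: mode_creation_def sum_2 y_def ip_add_left ip_add_right ip_scale_left
        ip_scale_right swap algebra_simps)
  also have "cnj (w p $ 1) * w p $ 1 + cnj (w p $ 2) * w p $ 2 = of_real ((norm (w p))\<^sup>2)"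
    using complex_norm_square[of "w p $ 1"] complex_norm_square[of "w p $ 2"]
    by (simp add: norm_complex2_squared mult.commute)
  finally have "(state_norm ip (mode_creation smul psid w p v))\<^sup>2
      = (norm (w p))\<^sup>2 * (state_norm ip v)\<^sup>2 - (state_norm ip y)\<^sup>2"
    unfolding ip_self_eq by (metis of_real_diff of_real_eq_iff of_real_mult)
  thus "(state_norm ip (mode_creation smul psid w p v))\<^sup>2 \<le> (norm (w p) * state_norm ip v)\<^sup>2"
    by (simp add: power_mult_distrib)
qed simp

text \<open>Telescoping: the creation operator of amplitude \<open>w\<close> on \<open>v\<close> is
  subtracted and added, which separates the change of state from the change of amplitude.\<close>

lemma mode_creation_diff:
  assumes "p \<in> P"
  shows "mode_creation smul psid w p u - mode_creation smul psid w' p v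
    = mode_creation smul psid w p (u - v) + mode_creation smul psid (\<lambda>p. w p - w' p) p v"
proof -
  interpret psid: Vector_Spaces.linear smul smul "psid p \<alpha>" for \<alpha>
    by (rule linear_psid[OF assms])
  show ?thesis
    by (simp add: mode_creation_def sum_2 psid.diff scale_right_diff_distrib scale_left_diff_distrib)
qed

text \<open>Every factor is a contraction, since its amplitude is a unit vector, and the vacuum is
  normalized.\<close>

lemma state_norm_filled_state_le_1:
  assumes "set ps \<subseteq> P" "\<And>p. p \<in> set ps \<Longrightarrow> norm (w p) = 1"
  shows "state_norm ip (filled_state smul psid vac w ps) \<le> 1"
  using assms
proof (induction ps)
  case Nil
  show ?case
    by (simp add: filled_state_def state_norm_def vac_normalized)
next
  case (Cons p ps)
  have "state_norm ip (filled_state smul psid vac w (p # ps))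
      \<le> norm (w p) * state_norm ip (filled_state smul psid vac w ps)"
    using state_norm_mode_creation_le[of p w] Cons.prems(1) by (simp add: filled_state_def)
  with Cons show ?case
    by simp
qed

text \<open>Peeling off the leftmost operator costs at most \<open>e\<close>: the amplitude
  difference acts on a state of norm at most 1, and the unit-amplitude operator does not enlarge the
  difference of the remaining products.\<close>

lemma state_norm_filled_state_diff_le:
  assumes "set ps \<subseteq> P"
    and "\<And>p. p \<in> set ps \<Longrightarrow> norm (w p) = 1" "\<And>p. p \<in> set ps \<Longrightarrow> norm (w' p) = 1"
    and "\<And>p. p \<in> set ps \<Longrightarrow> norm (w p - w' p) \<le> e"
  shows "state_norm ip (filled_state smul psid vac w ps - filled_state smul psid vac w' ps)
    \<le> real (length ps) * e"
  using assms
proof (induction ps)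
  case Nil
  show ?case
    by (simp add: filled_state_def)
next
  case (Cons p ps)
  let ?u = "filled_state smul psid vac w ps" and ?v = "filled_state smul psid vac w' ps"
  have p: "p \<in> P"
    using Cons.prems by simp
  have "filled_state smul psid vac w (p # ps) - filled_state smul psid vac w' (p # ps)
      = mode_creation smul psid w p (?u - ?v) + mode_creation smul psid (\<lambda>p. w p - w' p) p ?v"
    using mode_creation_diff[OF p] by (simp add: filled_state_def)
  hence "state_norm ip (filled_state smul psid vac w (p # ps) - filled_state smul psid vac w' (p # ps))
      \<le> norm (w p) * state_norm ip (?u - ?v) + norm (w p - w' p) * state_norm ip ?v"
    using state_norm_triangle state_norm_mode_creation_le[OF p, of w]
      state_norm_mode_creation_le[OF p, of "\<lambda>p. w p - w' p"]
    by (smt (verit, best))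
  \<comment> \<open>Monotonicity of the product needs \<open>0 \<le> e\<close>, which holds because
    \<open>e\<close> dominates a norm.\<close>
  also have "norm (w p - w' p) * state_norm ip ?v \<le> e * 1"
    using Cons.prems state_norm_filled_state_le_1[of ps w']
    by (intro mult_mono) (auto intro: order_trans[OF norm_ge_zero])
  also have "norm (w p) * state_norm ip (?u - ?v) \<le> real (length ps) * e"
    using Cons by simp
  finally show ?case
    by (simp add: algebra_simps)
qed

end


section \<open>The walk operator in matrix form\<close>

text \<open>The powers of an involution alternate between the identity and \<open>S\<close>, so the
  exponential series splits into its even part, cosh, and its odd part, sinh.\<close>

lemma mat_exp_cscale_involution:
  fixes S :: "complex^2^2"
  assumes "S ** S = mat 1"
  shows "mat_exp (cscale_mat c S) $ i $ j
    = (exp c + exp (- c)) / 2 * (mat 1 :: complex^2^2) $ i $ j + (exp c - exp (- c)) / 2 * S $ i $ j"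
proof -
  let ?A = "cscale_mat c S" and ?I = "mat 1 :: complex^2^2"
  have mult: "cscale_mat c S ** (cscale_mat d ?I + cscale_mat e S)
      = cscale_mat (c * e) ?I + cscale_mat (c * d) S" for d e
  proof -
    have "cscale_mat c S ** cscale_mat d X = cscale_mat (c * d) (S ** X)" for d X
      by (simp add: vec_eq_iff cscale_mat_def matrix_matrix_mult_def sum_2 algebra_simps)
    thus ?thesis
      using assms by (simp add: matrix_add_ldistrib add.commute)
  qed
  \<comment> \<open>The half sum and half difference of \<open>c ^ n\<close> and
    \<open>(- c) ^ n\<close> select even and odd exponents without a case split on parity.\<close>
  have pow: "((**) ?A ^^ n) ?I
      = cscale_mat ((c ^ n + (- c) ^ n) / 2) ?I + cscale_mat ((c ^ n - (- c) ^ n) / 2) S" for n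
  proof (induction n)
    case 0
    show ?case
      by (simp add: vec_eq_iff cscale_mat_def)
  next
    case (Suc n)
    show ?case
      by (simp only: funpow.simps o_apply Suc mult) (simp add: algebra_simps)
  qed
  \<comment> \<open>Each entry is a combination of two scalar exponential series; convergence of the
    entries then gives convergence of the matrices.\<close>
  have series: "(\<lambda>n. ((1 / fact n) *\<^sub>R ((**) ?A ^^ n) ?I) $ i $ j) sums
      ((exp c + exp (- c)) / 2 * ?I $ i $ j + (exp c - exp (- c)) / 2 * S $ i $ j)" for i j
  proof -
    have "(\<lambda>n. (c ^ n /\<^sub>R fact n + (- c) ^ n /\<^sub>R fact n) / 2 * ?I $ i $ j
          + (c ^ n /\<^sub>R fact n - (- c) ^ n /\<^sub>R fact n) / 2 * S $ i $ j) sums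
      ((exp c + exp (- c)) / 2 * ?I $ i $ j + (exp c - exp (- c)) / 2 * S $ i $ j)"
      by (intro sums_add sums_mult2 sums_divide sums_diff exp_converges)
    moreover have "((1 / fact n) *\<^sub>R ((**) ?A ^^ n) ?I) $ i $ j
        = (c ^ n /\<^sub>R fact n + (- c) ^ n /\<^sub>R fact n) / 2 * ?I $ i $ j
          + (c ^ n /\<^sub>R fact n - (- c) ^ n /\<^sub>R fact n) / 2 * S $ i $ j" for n
      unfolding pow by (simp add: cscale_mat_def scaleR_conv_of_real[where 'a = complex] field_simps)
    ultimately show ?thesis
      by simp
  qed
  have "(\<lambda>n. (1 / fact n) *\<^sub>R ((**) ?A ^^ n) ?I) sums
      (\<chi> i j. (exp c + exp (- c)) / 2 * ?I $ i $ j + (exp c - exp (- c)) / 2 * S $ i $ j)"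
    using series unfolding sums_def by (intro vec_tendstoI) simp
  thus ?thesis
    by (simp add: mat_exp_def sums_unique[symmetric])
qed

lemma mat_exp_rotation:
  fixes S :: "complex^2^2" and x :: real
  assumes "S ** S = mat 1"
  shows "mat_exp (cscale_mat (- \<i> * of_real x) S) $ i $ j
    = of_real (cos x) * (mat 1 :: complex^2^2) $ i $ j - \<i> * of_real (sin x) * S $ i $ j"
  unfolding mat_exp_cscale_involution[OF assms]
  by (simp add: cos_of_real[symmetric] sin_of_real[symmetric] cos_exp_eq sin_exp_eq field_simps)

text \<open>Both Pauli matrices are involutions, so both exponentials are explicit. The
  \<open>sigma_z\<close> factor is diagonal and multiplies the two columns by the phases
  \<open>cis (- (p * a))\<close> and \<open>cis (p * a)\<close>.\<close>

lemma walk_operator_entries: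
  "walk_operator m a p $ 1 $ 1 = of_real (cos (m * a)) * cis (- (p * a))"
  "walk_operator m a p $ 1 $ 2 = - \<i> * of_real (sin (m * a)) * cis (p * a)"
  "walk_operator m a p $ 2 $ 1 = - \<i> * of_real (sin (m * a)) * cis (- (p * a))"
  "walk_operator m a p $ 2 $ 2 = of_real (cos (m * a)) * cis (p * a)"
proof -
  have x: "sigma_x ** sigma_x = mat 1" and z: "sigma_z ** sigma_z = mat 1"
    by (simp_all add: vec_eq_iff forall_2 sigma_x_def sigma_z_def matrix_matrix_mult_def sum_2 mat_def)
  show "walk_operator m a p $ 1 $ 1 = of_real (cos (m * a)) * cis (- (p * a))"
    "walk_operator m a p $ 1 $ 2 = - \<i> * of_real (sin (m * a)) * cis (p * a)"
    "walk_operator m a p $ 2 $ 1 = - \<i> * of_real (sin (m * a)) * cis (- (p * a))"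
    "walk_operator m a p $ 2 $ 2 = of_real (cos (m * a)) * cis (p * a)"
    unfolding walk_operator_def matrix_matrix_mult_def vec_lambda_beta sum_2
      mat_exp_rotation[OF x] mat_exp_rotation[OF z]
    by (simp_all add: sigma_x_def sigma_z_def mat_def complex_eq_iff)
qed

text \<open>The rows of $K w = -s w$, where $K = i\,(U(p) - \cos(ma)\cos(pa))$ is Hermitian and traceless
  and $s$ is the imaginary part of the eigenvalue.\<close>

lemma walk_eigenvector_rows:
  assumes "normalized_eigenvector (walk_operator m a p) (walk_eigenvalue m a p) w"
  defines "s \<equiv> sqrt (1 - (cos (m * a))\<^sup>2 * (cos (p * a))\<^sup>2)"
  shows "of_real (cos (m * a) * sin (p * a)) * w $ 1 + of_real (sin (m * a)) * cis (p * a) * w $ 2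
      = - of_real s * w $ 1"
    and "of_real (sin (m * a)) * cis (- (p * a)) * w $ 1 - of_real (cos (m * a) * sin (p * a)) * w $ 2
      = - of_real s * w $ 2"
proof -
  let ?l = "of_real (cos (m * a) * cos (p * a)) + \<i> * of_real s :: complex"
  have "walk_operator m a p *v w = walk_eigenvalue m a p *s w"
    using assms(1) by (simp add: normalized_eigenvector_def)
  moreover have "walk_eigenvalue m a p = ?l"
    by (simp add: walk_eigenvalue_def s_def complex_eq_iff)
  ultimately have rows: "(walk_operator m a p *v w) $ i = ?l * w $ i" for i
    by (simp only: vector_smult_component)
  have cis: "cis (p * a) = of_real (cos (p * a)) + \<i> * of_real (sin (p * a))"
    "cis (- (p * a)) = of_real (cos (p * a)) - \<i> * of_real (sin (p * a))"
    by (simp_all add: complex_eq_iff)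
  \<comment> \<open>Multiplied by the imaginary unit, the eigenvalue equation becomes that of K: the
    terms with \<open>cos (m * a) * cos (p * a)\<close> on the two sides cancel.\<close>
  have "\<i> * (of_real (cos (m * a)) * cis (- (p * a)) * w $ 1
        + (- \<i> * of_real (sin (m * a)) * cis (p * a)) * w $ 2) = \<i> * (?l * w $ 1)"
    using rows[of 1] by (simp add: matrix_vector_mult_def sum_2 walk_operator_entries)
  thus "of_real (cos (m * a) * sin (p * a)) * w $ 1 + of_real (sin (m * a)) * cis (p * a) * w $ 2
      = - of_real s * w $ 1"
    unfolding cis by (simp add: algebra_simps eq_neg_iff_add_eq_0)
  have "\<i> * ((- \<i> * of_real (sin (m * a)) * cis (- (p * a))) * w $ 1
        + of_real (cos (m * a)) * cis (p * a) * w $ 2) = \<i> * (?l * w $ 2)"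
    using rows[of 2] by (simp add: matrix_vector_mult_def sum_2 walk_operator_entries)
  thus "of_real (sin (m * a)) * cis (- (p * a)) * w $ 1 - of_real (cos (m * a) * sin (p * a)) * w $ 2
      = - of_real s * w $ 2"
    unfolding cis by (simp add: algebra_simps eq_neg_iff_add_eq_0)
qed

lemma dirac_eigenvector_rows:
  assumes "normalized_eigenvector (dirac_hamiltonian m p) (- of_real \<omega>) w"
  shows "of_real p * w $ 1 + of_real m * w $ 2 = - of_real \<omega> * w $ 1"
    and "of_real m * w $ 1 - of_real p * w $ 2 = - of_real \<omega> * w $ 2"
proof -
  have rows: "(dirac_hamiltonian m p *v w) $ i = - of_real \<omega> * w $ i" for i
    using assms by (simp add: normalized_eigenvector_def)
  show "of_real p * w $ 1 + of_real m * w $ 2 = - of_real \<omega> * w $ 1"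
    "of_real m * w $ 1 - of_real p * w $ 2 = - of_real \<omega> * w $ 2"
    using rows[of 1] rows[of 2]
    by (simp_all add: dirac_hamiltonian_def matrix_vector_mult_def sum_2 sigma_x_def sigma_z_def
        scaleR_conv_of_real[where 'a = complex])
qed


section \<open>Comparison of the single-particle eigenvectors\<close>

text \<open>The determinant of the pair has the modulus of the component of \<open>v\<close>
  orthogonal to \<open>w\<close>. By Lagrange's identity its square and that of the overlap \<alpha>
  add up to 1, while the squared distance is 2 - 2 \<alpha>.\<close>

lemma norm_diff_le_of_nonneg_overlap:
  fixes w v :: "complex^2"
  assumes "norm w = 1" "norm v = 1" "cinner2 w v \<in> \<real>" "0 \<le> Re (cinner2 w v)"
  shows "(norm (v - w))\<^sup>2 \<le> 2 * (cmod (w $ 1 * v $ 2 - w $ 2 * v $ 1))\<^sup>2"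
    and "cmod (w $ 1 * v $ 2 - w $ 2 * v $ 1) \<le> 1"
proof -
  define \<alpha> where "\<alpha> = Re (cinner2 w v)"
  let ?b = "cmod (w $ 1 * v $ 2 - w $ 2 * v $ 1)"
  have w: "(cmod (w $ 1))\<^sup>2 + (cmod (w $ 2))\<^sup>2 = 1" and v: "(cmod (v $ 1))\<^sup>2 + (cmod (v $ 2))\<^sup>2 = 1"
    using assms norm_complex2_squared[of w] norm_complex2_squared[of v] by simp_all
  have \<alpha>: "cmod (cinner2 w v) = \<alpha>"
    using assms(3,4) by (auto simp: \<alpha>_def Reals_def)
  have "(cmod (cinner2 w v))\<^sup>2 + ?b\<^sup>2
      = ((cmod (w $ 1))\<^sup>2 + (cmod (w $ 2))\<^sup>2) * ((cmod (v $ 1))\<^sup>2 + (cmod (v $ 2))\<^sup>2)"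
    unfolding cinner2_def sum_2 cmod_power2 by (simp add: power2_eq_square algebra_simps)
  hence lagrange: "\<alpha>\<^sup>2 + ?b\<^sup>2 = 1"
    by (simp add: \<alpha> v w)
  hence "?b\<^sup>2 \<le> 1\<^sup>2"
    using zero_le_power2[of \<alpha>] unfolding one_power2 by linarith
  thus "?b \<le> 1"
    by (rule power2_le_imp_le) simp
  have "\<alpha>\<^sup>2 \<le> 1\<^sup>2"
    using lagrange zero_le_power2[of ?b] unfolding one_power2 by linarith
  hence "\<alpha> \<le> 1"
    by (rule power2_le_imp_le) simp
  have "(norm (v - w))\<^sup>2 = ((cmod (v $ 1))\<^sup>2 + (cmod (v $ 2))\<^sup>2)
      + ((cmod (w $ 1))\<^sup>2 + (cmod (w $ 2))\<^sup>2) - 2 * \<alpha>"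
    unfolding norm_complex2_squared cmod_power2 \<alpha>_def cinner2_def sum_2
    by (simp add: power2_eq_square algebra_simps)
  also have "\<dots> = 2 - 2 * \<alpha>"
    using v w by simp
  \<comment> \<open>The phase convention enters here: \<alpha> lies between 0 and 1, so it dominates
    its square.\<close>
  also have "\<dots> \<le> 2 - 2 * \<alpha>\<^sup>2"
    using \<open>\<alpha> \<le> 1\<close> assms(4) mult_left_le[of \<alpha> \<alpha>] by (simp add: \<alpha>_def power2_eq_square)
  finally show "(norm (v - w))\<^sup>2 \<le> 2 * ?b\<^sup>2"
    using lagrange by simp
qed

section \<open>Elementary trigonometric estimates\<close>

lemma abs_sin_minus_self_le: "\<bar>sin x - x\<bar> \<le> x\<^sup>2 / 2" for x :: real
  using Maclaurin_sin_bound[of x 2] by (simp add: numeral_2_eq_2 sin_coeff_def)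

lemma abs_cos_minus_1_le: "\<bar>cos x - 1\<bar> \<le> x\<^sup>2 / 2" for x :: real
proof -
  have "1 - cos x = 2 * (sin (x / 2))\<^sup>2"
    using cos_double_sin[of "x / 2"] by simp
  moreover have "(sin (x / 2))\<^sup>2 \<le> (x / 2)\<^sup>2"
    using abs_sin_x_le_abs_x[of "x / 2"] abs_le_square_iff by blast
  ultimately show ?thesis
    by (simp add: power_divide)
qed

lemma norm_cis_minus_1_le: "cmod (cis x - 1) \<le> \<bar>x\<bar>"
proof (rule power2_le_imp_le)
  have "(cmod (cis x - 1))\<^sup>2 = 2 * (1 - cos x)"
    unfolding cmod_power2 using sin_cos_squared_add[of x]
    by (simp add: power2_eq_square algebra_simps)
  thus "(cmod (cis x - 1))\<^sup>2 \<le> \<bar>x\<bar>\<^sup>2"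
    using abs_cos_minus_1_le[of x] by simp
qed simp

text \<open>Exhibits the squared eigenvalue of K as a sum of two squares, so that the eigenvalue is
  the length of a plane vector.\<close>

lemma walk_eigenvalue_Im_eq:
  "1 - (cos x)\<^sup>2 * (cos y)\<^sup>2 = (cos x * sin y)\<^sup>2 + (sin x)\<^sup>2" for x y :: real
  by (simp add: sin_squared_eq power_mult_distrib algebra_simps)

text \<open>Applied with $x = ma$ and $y = pa$ to the entries and eigenvalues of $K$ and $a\,h(p)$.\<close>

lemma walk_hamiltonian_bounds:
  fixes x y :: real
  defines "\<rho> \<equiv> sqrt (x\<^sup>2 + y\<^sup>2)"
  shows "\<bar>cos x * sin y - y\<bar> \<le> \<rho>\<^sup>2 / 2"
    and "cmod (of_real (sin x) * cis y - of_real x) \<le> \<rho>\<^sup>2"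
    and "\<bar>sqrt (1 - (cos x)\<^sup>2 * (cos y)\<^sup>2) - \<rho>\<bar> \<le> \<rho>\<^sup>2"
proof -
  have \<rho>: "\<rho>\<^sup>2 = x\<^sup>2 + y\<^sup>2"
    by (simp add: \<rho>_def)
  have "\<bar>cos x * sin y - y\<bar> \<le> \<bar>(cos x - 1) * sin y\<bar> + \<bar>sin y - y\<bar>"
    by (simp add: algebra_simps)
  also have "\<bar>(cos x - 1) * sin y\<bar> \<le> x\<^sup>2 / 2 * 1"
    unfolding abs_mult by (intro mult_mono abs_cos_minus_1_le) auto
  finally show k: "\<bar>cos x * sin y - y\<bar> \<le> \<rho>\<^sup>2 / 2"
    using abs_sin_minus_self_le[of y] by (simp add: \<rho> add_divide_distrib)
  have "of_real (sin x) * cis y - of_real x = of_real (sin x) * (cis y - 1) + of_real (sin x - x)"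
    by (simp add: algebra_simps)
  hence "cmod (of_real (sin x) * cis y - of_real x)
      \<le> cmod (of_real (sin x) * (cis y - 1)) + \<bar>sin x - x\<bar>"
    by (metis norm_of_real norm_triangle_ineq)
  moreover have "cmod (of_real (sin x) * (cis y - 1)) \<le> \<bar>x\<bar> * \<bar>y\<bar>"
    unfolding norm_mult norm_of_real by (intro mult_mono abs_sin_x_le_abs_x norm_cis_minus_1_le) auto
  moreover have "2 * (\<bar>x\<bar> * \<bar>y\<bar>) \<le> x\<^sup>2 + y\<^sup>2"
    using zero_le_power2[of "\<bar>x\<bar> - \<bar>y\<bar>"] by (simp add: power2_diff)
  ultimately show "cmod (of_real (sin x) * cis y - of_real x) \<le> \<rho>\<^sup>2"
    using abs_sin_minus_self_le[of x] zero_le_power2[of y] unfolding \<rho> by linarith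
  \<comment> \<open>Both eigenvalues are moduli of complex numbers, so the reverse triangle
    inequality bounds their difference by differences of matrix entries.\<close>
  have "sqrt (1 - (cos x)\<^sup>2 * (cos y)\<^sup>2) = cmod (Complex (cos x * sin y) (sin x))"
    by (simp add: walk_eigenvalue_Im_eq complex_norm)
  moreover have "\<rho> = cmod (Complex y x)"
    by (simp add: \<rho>_def complex_norm add.commute)
  ultimately have "\<bar>sqrt (1 - (cos x)\<^sup>2 * (cos y)\<^sup>2) - \<rho>\<bar>
      \<le> cmod (Complex (cos x * sin y) (sin x) - Complex y x)"
    by (simp add: norm_triangle_ineq3)
  also have "\<dots> \<le> \<bar>cos x * sin y - y\<bar> + \<bar>sin x - x\<bar>"
    using cmod_le[of "Complex (cos x * sin y) (sin x) - Complex y x"] by simp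
  finally show "\<bar>sqrt (1 - (cos x)\<^sup>2 * (cos y)\<^sup>2) - \<rho>\<bar> \<le> \<rho>\<^sup>2"
    using k abs_sin_minus_self_le[of x] zero_le_power2[of y] unfolding \<rho> by argo
qed

text \<open>For a Hermitian traceless matrix with eigenvector $(x, y)$ of eigenvalue $-s$, the vector
  $(-\bar y, \bar x)$ is an eigenvector of eigenvalue $s$; pairing it with $(K + s)(u, v)$
  gives the identity.\<close>

lemma traceless_hermitian_overlap:
  fixes x y u v k z z' s :: complex
  assumes "k * x + z * y = - s * x" "z' * x - k * y = - s * y"
  shows "2 * s * (x * v - y * u) = x * (z' * u - k * v + s * v) - y * (k * u + z * v + s * u)"
  using assms by algebra

text \<open>The Dirac eigenvector is almost an eigenvector of K: (K + s) \<open>w\<close> is of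
  second order in \<rho>, because a (h + \<omega>) annihilates \<open>w\<close>. Dividing by the gap
  2 s, of first order for small \<rho>, bounds the orthogonal component.\<close>

lemma eigenvector_diff_bound:
  assumes "a > 0" "m > 0"
    and w: "normalized_eigenvector (dirac_hamiltonian m p) (- of_real (sqrt (p\<^sup>2 + m\<^sup>2))) w"
    and wd: "normalized_eigenvector (walk_operator m a p) (walk_eigenvalue m a p) wd"
    and real: "cinner2 wd w \<in> \<real>" "0 \<le> Re (cinner2 wd w)"
  shows "norm (w - wd) \<le> 8 * (a * sqrt (p\<^sup>2 + m\<^sup>2))"
proof -
  define \<omega> where "\<omega> = sqrt (p\<^sup>2 + m\<^sup>2)"
  define \<rho> where "\<rho> = a * \<omega>"
  define s where "s = sqrt (1 - (cos (m * a))\<^sup>2 * (cos (p * a))\<^sup>2)"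
  define k where "k = cos (m * a) * sin (p * a)"
  define z where "z = of_real (sin (m * a)) * cis (p * a)"
  define b where "b = cmod (wd $ 1 * w $ 2 - wd $ 2 * w $ 1)"
  \<comment> \<open>\<open>e1\<close> and \<open>e2\<close> are the entries of the residual (K + s)
    \<open>w\<close>.\<close>
  define e1 where "e1 = of_real k * w $ 1 + z * w $ 2 + of_real s * w $ 1"
  define e2 where "e2 = cnj z * w $ 1 - of_real k * w $ 2 + of_real s * w $ 2"
  have \<rho>_eq: "sqrt ((m * a)\<^sup>2 + (p * a)\<^sup>2) = \<rho>"
    using \<open>a > 0\<close> real_sqrt_mult[of "a\<^sup>2" "p\<^sup>2 + m\<^sup>2"]
    by (simp add: \<rho>_def \<omega>_def algebra_simps power_mult_distrib)
  have "0 < \<rho>"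
    using assms(1,2) by (simp add: \<rho>_def \<omega>_def add_nonneg_pos)
  have bounds: "\<bar>k - p * a\<bar> \<le> \<rho>\<^sup>2 / 2" "cmod (z - of_real (m * a)) \<le> \<rho>\<^sup>2" "\<bar>s - \<rho>\<bar> \<le> \<rho>\<^sup>2"
    using walk_hamiltonian_bounds[of "m * a" "p * a"] by (simp_all add: \<rho>_eq k_def z_def s_def)
  have norms: "norm w = 1" "norm wd = 1"
    using w wd by (simp_all add: normalized_eigenvector_def)
  have le1: "cmod (w $ i) \<le> 1" "cmod (wd $ i) \<le> 1" for i
    using norms Finite_Cartesian_Product.norm_nth_le[of w i]
      Finite_Cartesian_Product.norm_nth_le[of wd i] by simp_all
  note h = dirac_eigenvector_rows[OF w, folded \<omega>_def]
  have bound: "cmod (c * x + d * y + e * t) \<le> \<rho>\<^sup>2 / 2 + \<rho>\<^sup>2 + \<rho>\<^sup>2"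
    if "cmod c \<le> \<rho>\<^sup>2 / 2" "cmod d \<le> \<rho>\<^sup>2" "cmod e \<le> \<rho>\<^sup>2" "cmod x \<le> 1" "cmod y \<le> 1" "cmod t \<le> 1"
    for c d e x y t
  proof -
    have "cmod (c * x + d * y + e * t) \<le> cmod (c * x) + cmod (d * y) + cmod (e * t)"
      by (meson norm_triangle_ineq norm_triangle_mono order_refl)
    also have "\<dots> \<le> \<rho>\<^sup>2 / 2 * 1 + \<rho>\<^sup>2 * 1 + \<rho>\<^sup>2 * 1"
      unfolding norm_mult using that by (intro add_mono mult_mono) auto
    finally show ?thesis
      by simp
  qed
  \<comment> \<open>Subtracting \<open>a\<close> times the Dirac row, which vanishes, leaves only
    differences of entries and eigenvalues.\<close>
  have "e1 = of_real (k - p * a) * w $ 1 + (z - of_real (m * a)) * w $ 2 + of_real (s - \<rho>) * w $ 1"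
    using h(1) by (simp add: e1_def \<rho>_def) algebra
  hence e1: "cmod e1 \<le> \<rho>\<^sup>2 / 2 + \<rho>\<^sup>2 + \<rho>\<^sup>2"
    using bounds le1 by (simp only: norm_of_real bound)
  have "e2 = of_real (- (k - p * a)) * w $ 2 + cnj (z - of_real (m * a)) * w $ 1 + of_real (s - \<rho>) * w $ 2"
    using h(2) by (simp add: e2_def \<rho>_def) algebra
  hence e2: "cmod e2 \<le> \<rho>\<^sup>2 / 2 + \<rho>\<^sup>2 + \<rho>\<^sup>2"
    using bounds le1 by (simp only: norm_of_real bound abs_minus_cancel complex_mod_cnj)
  have "2 * of_real s * (wd $ 1 * w $ 2 - wd $ 2 * w $ 1) = wd $ 1 * e2 - wd $ 2 * e1"
    unfolding e1_def e2_def
    using walk_eigenvector_rows[OF wd]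
    by (intro traceless_hermitian_overlap) (simp_all add: k_def z_def s_def cis_cnj)
  hence "cmod (2 * of_real s * (wd $ 1 * w $ 2 - wd $ 2 * w $ 1)) \<le> cmod (wd $ 1 * e2) + cmod (wd $ 2 * e1)"
    by (simp add: norm_triangle_ineq4)
  also have "\<dots> \<le> 1 * (\<rho>\<^sup>2 / 2 + \<rho>\<^sup>2 + \<rho>\<^sup>2) + 1 * (\<rho>\<^sup>2 / 2 + \<rho>\<^sup>2 + \<rho>\<^sup>2)"
    unfolding norm_mult using e1 e2 le1 by (intro add_mono mult_mono) auto
  finally have sb: "2 * \<bar>s\<bar> * b \<le> 5 * \<rho>\<^sup>2"
    by (simp add: b_def norm_mult)
  note overlap = norm_diff_le_of_nonneg_overlap[OF norms(2,1) real, folded b_def]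
  have b: "0 \<le> b"
    by (simp add: b_def)
  have "b \<le> 5 * \<rho>"
  \<comment> \<open>For small \<rho> the error in \<open>s\<close> is at most half of \<rho>, so
    \<open>s\<close> is at least half of \<rho> and can be divided out. Otherwise the trivial bound
    \<open>b \<le> 1\<close> is enough.\<close>
  proof (cases "\<rho> \<le> 1 / 2")
    case True
    hence "\<rho> * \<rho> \<le> \<rho> * (1 / 2)"
      using \<open>0 < \<rho>\<close> by (intro mult_left_mono) auto
    hence "\<rho> \<le> 2 * \<bar>s\<bar>"
      using bounds(3) by (simp add: power2_eq_square)
    hence "\<rho> * b \<le> \<rho> * (5 * \<rho>)"
      using sb mult_right_mono[of \<rho> "2 * \<bar>s\<bar>" b] b by (simp add: power2_eq_square)
    thus ?thesis
      using \<open>0 < \<rho>\<close> by simp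
  next
    case False
    thus ?thesis
      using overlap(2) by simp
  qed
  have "(norm (w - wd))\<^sup>2 \<le> 2 * (5 * \<rho>)\<^sup>2"
    using overlap(1) power_mono[OF \<open>b \<le> 5 * \<rho>\<close> b, of 2] by linarith
  \<comment> \<open>The constant 8 rounds up 5 times the square root of 2.\<close>
  also have "\<dots> \<le> (8 * \<rho>)\<^sup>2"
    by (simp add: power_mult_distrib)
  finally have "norm (w - wd) \<le> 8 * \<rho>"
    by (rule power2_le_imp_le) (simp add: \<open>0 < \<rho>\<close> less_imp_le)
  thus ?thesis
    by (simp add: \<rho>_def \<omega>_def)
qed


section \<open>Counting momenta\<close>

text \<open>The momenta are indexed by integers of modulus at most \<open>x\<close>, where
  \<open>x\<close> is the cutoff in units of the momentum spacing; the additive 1 counts zero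
  momentum.\<close>

lemma card_cutoff_momenta_le:
  assumes "L0 > 0" "\<Lambda> \<ge> 0"
  shows "real (card (cutoff_momenta L0 \<Lambda>)) \<le> L0 / pi * \<Lambda> + 1"
proof -
  define x where "x = L0 / (2 * pi) * \<Lambda>"
  have x: "0 \<le> x"
    using assms by (simp add: x_def)
  have "cutoff_momenta L0 \<Lambda> \<subseteq> (\<lambda>k::int. 2 * pi / L0 * of_int k) ` {-\<lfloor>x\<rfloor>..\<lfloor>x\<rfloor>}"
  proof
    fix p assume "p \<in> cutoff_momenta L0 \<Lambda>"
    then obtain k :: int where k: "p = 2 * pi / L0 * of_int k" "\<bar>p\<bar> \<le> \<Lambda>"
      unfolding cutoff_momenta_def momenta_def by blast
    hence "2 * pi / L0 * \<bar>of_int k\<bar> \<le> \<Lambda>"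
      using assms by (simp add: abs_mult)
    hence "\<bar>of_int k\<bar> \<le> x"
      using assms by (simp add: x_def field_simps)
    hence "k \<le> \<lfloor>x\<rfloor>" "- k \<le> \<lfloor>x\<rfloor>"
      by (simp_all add: le_floor_iff)
    thus "p \<in> (\<lambda>k::int. 2 * pi / L0 * of_int k) ` {-\<lfloor>x\<rfloor>..\<lfloor>x\<rfloor>}"
      using k(1) by auto
  qed
  hence "card (cutoff_momenta L0 \<Lambda>) \<le> card {-\<lfloor>x\<rfloor>..\<lfloor>x\<rfloor>}"
    by (rule surj_card_le[rotated]) simp
  also have "\<dots> = nat (2 * \<lfloor>x\<rfloor> + 1)"
    by simp
  finally have "real (card (cutoff_momenta L0 \<Lambda>)) \<le> 2 * of_int \<lfloor>x\<rfloor> + 1"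
    using x by (simp add: le_nat_iff)
  also have "\<dots> \<le> 2 * x + 1"
    by simp
  finally show ?thesis
    by (simp add: x_def)
qed

section \<open>Assembly of the many-particle estimate\<close>

theorem theorem4p1:
  fixes m L0 :: real
    and smul :: "complex \<Rightarrow> 'v::ab_group_add \<Rightarrow> 'v"
    and ip :: "'v \<Rightarrow> 'v \<Rightarrow> complex"
    and psi psid :: "real \<Rightarrow> 2 \<Rightarrow> 'v \<Rightarrow> 'v"
    and vac :: 'v
    and w :: "real \<Rightarrow> complex^2"
    and wd :: "real \<Rightarrow> real \<Rightarrow> complex^2"
  assumes "m > 0" and "L0 > 0"
    and "fermion_modes smul ip (momenta L0) psi psid vac"
    and "\<And>p. p \<in> momenta L0 \<Longrightarrow>
      normalized_eigenvector (dirac_hamiltonian m p) (- of_real (sqrt (p\<^sup>2 + m\<^sup>2))) (w p)"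
    and "\<And>a p. a \<in> lattice_spacings L0 \<Longrightarrow> p \<in> momenta L0 \<Longrightarrow> \<bar>p\<bar> < pi / a \<Longrightarrow>
      normalized_eigenvector (walk_operator m a p) (walk_eigenvalue m a p) (wd a p)"
    and "\<And>a p. a \<in> lattice_spacings L0 \<Longrightarrow> p \<in> momenta L0 \<Longrightarrow> \<bar>p\<bar> < pi / a \<Longrightarrow>
      cinner2 (wd a p) (w p) \<in> \<real> \<and> 0 \<le> Re (cinner2 (wd a p) (w p))"
  shows "\<exists>C::real. \<forall>(\<Lambda>::real \<Rightarrow> real) (ps::real \<Rightarrow> real list).
    (\<forall>a\<in>lattice_spacings L0. \<Lambda> a < pi / a) \<longrightarrow>
    filterlim \<Lambda> at_top (at 0 within lattice_spacings L0) \<longrightarrow>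
    (\<forall>a\<in>lattice_spacings L0. distinct (ps a) \<and> set (ps a) = cutoff_momenta L0 (\<Lambda> a)) \<longrightarrow>
      (\<forall>\<^sub>F a in at 0 within lattice_spacings L0.
         state_norm ip (filled_state smul psid vac w (ps a) -
                        filled_state smul psid vac (wd a) (ps a)) \<le> C * (\<Lambda> a)^3 * a) \<and>
      (((\<lambda>a. (\<Lambda> a)^3 * a) \<longlongrightarrow> 0) (at 0 within lattice_spacings L0) \<longrightarrow>
       ((\<lambda>a. state_norm ip (filled_state smul psid vac w (ps a) -
                             filled_state smul psid vac (wd a) (ps a))) \<longlongrightarrow> 0)
         (at 0 within lattice_spacings L0))"
proof -
  interpret fermion_modes smul ip "momenta L0" psi psid vac
    by (rule assms(3))
  let ?F = "at 0 within lattice_spacings L0"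
  \<comment> \<open>The factor 16 is the 8 of the eigenvector bound times the 2 in \<omega> \<le> 2
    \<Lambda>; the other factor comes from counting the momenta.\<close>
  define C where "C = 16 * (L0 / pi + 1)"
  show ?thesis
  proof (rule exI[of _ C], intro allI impI)
    fix \<Lambda> :: "real \<Rightarrow> real" and ps :: "real \<Rightarrow> real list"
    let ?d = "\<lambda>a. state_norm ip (filled_state smul psid vac w (ps a) -
                        filled_state smul psid vac (wd a) (ps a))"
    assume \<Lambda>_less: "\<forall>a\<in>lattice_spacings L0. \<Lambda> a < pi / a"
      and \<Lambda>_top: "filterlim \<Lambda> at_top ?F"
      and ps: "\<forall>a\<in>lattice_spacings L0. distinct (ps a) \<and> set (ps a) = cutoff_momenta L0 (\<Lambda> a)"
    \<comment> \<open>The threshold \<open>m\<close> gives \<omega> \<le> 2 \<Lambda>, and the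
      threshold 1 lets powers of \<Lambda> absorb the additive 1 of the count.\<close>
    have bound: "?d a \<le> C * (\<Lambda> a)^3 * a"
      if a: "a \<in> lattice_spacings L0" and \<Lambda>: "max 1 m \<le> \<Lambda> a" for a
    proof -
      have "a > 0" and \<Lambda>1: "1 \<le> \<Lambda> a" "m \<le> \<Lambda> a"
        using a \<Lambda> by (simp_all add: lattice_spacings_def)
      \<comment> \<open>As \<open>\<Lambda> a < pi / a\<close>, all occupied momenta lie where the
        discrete eigenvectors are specified.\<close>
      have mode: "p \<in> momenta L0" "\<bar>p\<bar> \<le> \<Lambda> a" "\<bar>p\<bar> < pi / a" if "p \<in> set (ps a)" for p
        using that ps a \<Lambda>_less by (fastforce simp: cutoff_momenta_def)+
      have "?d a \<le> real (length (ps a)) * (16 * (a * \<Lambda> a))"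
      proof (rule state_norm_filled_state_diff_le)
        show "set (ps a) \<subseteq> momenta L0"
          using mode by blast
        fix p assume p: "p \<in> set (ps a)"
        note w = assms(4)[OF mode(1)[OF p]] and wd = assms(5)[OF a mode(1)[OF p] mode(3)[OF p]]
        show "norm (w p) = 1" "norm (wd a p) = 1"
          using w wd by (simp_all add: normalized_eigenvector_def)
        have "norm (w p - wd a p) \<le> 8 * (a * sqrt (p\<^sup>2 + m\<^sup>2))"
          using assms(6)[OF a mode(1)[OF p] mode(3)[OF p]] assms(1)
          by (intro eigenvector_diff_bound \<open>a > 0\<close> w wd) auto
        also have "sqrt (p\<^sup>2 + m\<^sup>2) \<le> \<bar>p\<bar> + \<bar>m\<bar>"
          by (rule sqrt_sum_squares_le_sum_abs)
        also have "\<dots> \<le> 2 * \<Lambda> a"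
          using mode(2)[OF p] \<Lambda>1 assms(1) by simp
        finally show "norm (w p - wd a p) \<le> 16 * (a * \<Lambda> a)"
          using \<open>a > 0\<close> by (simp add: mult_left_mono)
      qed
      also have "real (length (ps a)) \<le> L0 / pi * \<Lambda> a + 1"
        using ps a card_cutoff_momenta_le[OF assms(2), of "\<Lambda> a"] \<Lambda>1
        by (metis distinct_card order_trans zero_le_one)
      \<comment> \<open>One power of \<Lambda> is given away here to arrive at the cubic
        rate.\<close>
      also have "\<dots> \<le> (L0 / pi + 1) * (\<Lambda> a)\<^sup>2"
      proof -
        have "\<Lambda> a \<le> (\<Lambda> a)\<^sup>2" "1 \<le> (\<Lambda> a)\<^sup>2"
          using \<Lambda>1 by (simp_all add: self_le_power)
        thus ?thesis
          using assms(2) mult_left_mono[of "\<Lambda> a" "(\<Lambda> a)\<^sup>2" "L0 / pi"] by (simp add: algebra_simps)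
      qed
      finally show ?thesis
        using \<open>a > 0\<close> \<Lambda>1 by (simp add: C_def power2_eq_square power3_eq_cube algebra_simps)
    qed
    have "\<forall>\<^sub>F a in ?F. max 1 m \<le> \<Lambda> a"
      using \<Lambda>_top unfolding filterlim_at_top by blast
    moreover have "\<forall>\<^sub>F a in ?F. a \<in> lattice_spacings L0"
      by (simp add: eventually_at_topological) blast
    ultimately have ev: "\<forall>\<^sub>F a in ?F. ?d a \<le> C * (\<Lambda> a)^3 * a"
      by eventually_elim (rule bound)
    show "(\<forall>\<^sub>F a in ?F. ?d a \<le> C * (\<Lambda> a)^3 * a) \<and>
      (((\<lambda>a. (\<Lambda> a)^3 * a) \<longlongrightarrow> 0) ?F \<longrightarrow> (?d \<longlongrightarrow> 0) ?F)"
    proof (intro conjI impI ev)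
      assume "((\<lambda>a. (\<Lambda> a)^3 * a) \<longlongrightarrow> 0) ?F"
      hence lim: "((\<lambda>a. C * (\<Lambda> a)^3 * a) \<longlongrightarrow> 0) ?F"
        by (simp add: mult.assoc tendsto_mult_right_zero)
      show "(?d \<longlongrightarrow> 0) ?F"
        by (rule tendsto_sandwich[OF _ ev tendsto_const lim]) simp
    qed
  qed
qed

end
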